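(* Let $E_n(x)=\frac{a_0}{2}+\sum_{l=1}^{n}\bigl(a_l\cosh(lx)+b_l\sinh(lx)\bigr)$ be an exponential polynomial for which at least one of the leading coefficients $a_n,b_n$ is nonzero, and which has real roots $x_1,\dots,x_m$ with known multiplicities $\alpha_1,\dots,\alpha_m$ respectively, where $\alpha_1+\dots+\alpha_m=2n$. Let $d=\min_{i\neq j}|x_i-x_j|$. Let $q$ and $c$ be real numbers such that $$1>q>0,\qquad c>0,\qquad d-2c>0,\qquad \tfrac12\cosh(c/2)+\tfrac18\,c\,|\sinh(c/2)|<6,\qquad \cosh(c/2)<2,$$ and $$c^2\bigl(4n+(S^2-2)\alpha_i\bigr)<S^2\alpha_i,\qquad i=1,\dots,m,\qquad\text{where } S=\sinh\!\left(\frac{d-2c}{2}\right).$$ Let the initial approximations $x_i^{[0]}$ be taken such that $|x_i^{[0]}-x_i|\le cq$ for $i=1,\dots,m$, and let the sequences $x_i^{[k]}$ be generated by $$x_i^{[k+1]}=x_i^{[k]}-\alpha_i E_n\bigl(x_i^{[k]}\bigr)\left[E_n'\bigl(x_i^{[k]}\bigr)-E_n\bigl(x_i^{[k]}\bigr)\frac{Q_i'^{[k]}\bigl(x_i^{[k]}\bigr)}{Q_i^{[k]}\bigl(x_i^{[k]}\bigr)}\right]^{-1},\qquad i=1,\dots,m,\ k=0,1,2,\dots,$$ where $$Q_i^{[k]}(x)=\prod_{j=1,\,j\ne i}^{m}\sinh^{\alpha_j}\!\left(\frac{x-x_j^{[k]}}{2}\right).$$ Then for every $k\in\mathbb{N}$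 the inequalities $$\bigl|x_i^{[k]}-x_i\bigr|\le c\,q^{3^k},\qquad i=1,\dots,m,$$ hold true.
   Context: The coefficients $a_l,b_l$ are real. The real roots $x_1,\dots,x_m$ are pairwise distinct and $\alpha_i$ is the multiplicity of $x_i$ as a root of $E_n$. The initial approximations are real. The notation $Q_i'^{[k]}$ denotes the derivative with respect to $x$ of the function $Q_i^{[k]}$; $x_i^{[k]}$ denotes the $k$-th approximation to $x_i$. *)

theory Defs
  imports "HOL-Analysis.Analysis"
begin

definition exp_poly :: "nat \<Rightarrow> (nat \<Rightarrow> real) \<Rightarrow> (nat \<Rightarrow> real) \<Rightarrow> real \<Rightarrow> real" where
  "exp_poly n a b x =
     a 0 / 2 + (\<Sum>l = 1..n. a l * cosh (real l * x) + b l * sinh (real l * x))"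

definition has_root_mult :: "(real \<Rightarrow> real) \<Rightarrow> real \<Rightarrow> nat \<Rightarrow> bool" where
  "has_root_mult f x \<alpha> \<longleftrightarrow>
     \<alpha> > 0 \<and> (\<forall>s<\<alpha>. (deriv ^^ s) f x = 0) \<and> (deriv ^^ \<alpha>) f x \<noteq> 0"

text \<open>Here \<open>y j\<close> is the current approximation of the \<open>j\<close>-th root; indices run over \<open>{1..m}\<close>.\<close>

definition Q_prod ::
    "nat \<Rightarrow> (nat \<Rightarrow> nat) \<Rightarrow> (nat \<Rightarrow> real) \<Rightarrow> nat \<Rightarrow> real \<Rightarrow> real" where
  "Q_prod m \<alpha> y i x = (\<Prod>j\<in>{1..m} - {i}. sinh ((x - y j) / 2) ^ \<alpha> j)"

text \<open>
  Division is total, with \<open>inverse 0 = 0\<close>. Hence if \<open>y i\<close> is already a root of \<open>E\<close>, the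
  step leaves it unchanged, even at a multiple root, where the bracket vanishes as well.
\<close>

definition root_step ::
    "(real \<Rightarrow> real) \<Rightarrow> nat \<Rightarrow> (nat \<Rightarrow> nat) \<Rightarrow> (nat \<Rightarrow> real) \<Rightarrow> nat \<Rightarrow> real" where
  "root_step E m \<alpha> y i =
     y i - real (\<alpha> i) * E (y i) *
       inverse (deriv E (y i) - E (y i) * (deriv (Q_prod m \<alpha> y i) (y i) / Q_prod m \<alpha> y i (y i)))"

end

theory Submission
  imports Defs
begin

text \<open>
  Substituting \<open>z = exp x\<close> turns \<open>E\<close> into \<open>exp (- n x)\<close> times a polynomial of degree at most \<open>2 n\<close>,
  so the multiplicities force \<open>E x = K * (\<Prod>j. sinh ((x - r j) / 2) ^ \<alpha> j)\<close>. Taking logarithmic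
  derivatives, an error \<open>t\<close> at the \<open>i\<close>-th root becomes \<open>t - 2 T / (1 + w T)\<close> with
  \<open>T = tanh (t / 2)\<close>, where \<open>w\<close> is a weighted sum of differences of \<open>coth\<close> and hence is itself
  of the order of the errors. As \<open>t - 2 T\<close> and \<open>t w T\<close> are both cubic, the errors
  are cubed up to a constant, which the hypothesis on \<open>c\<close> makes at most \<open>1 / c\<^sup>2\<close>.
\<close>

section \<open>Factorization of exponential polynomials\<close>

text \<open>Differentiating \<open>exp (- n x) * poly p (exp x)\<close> amounts to applying this operator to \<open>p\<close>.\<close>

definition exp_pderiv :: "real \<Rightarrow> real poly \<Rightarrow> real poly" where
  "exp_pderiv c p = [:0, 1:] * pderiv p - smult c p"

lemma higher_deriv_exp_poly:
  "(deriv ^^ s) (\<lambda>x. exp (- (c * x)) * poly p (exp x)) =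
     (\<lambda>x. exp (- (c * x)) * poly ((exp_pderiv c ^^ s) p) (exp x))"
proof (induction s)
  case (Suc s)
  have "((\<lambda>x. exp (- (c * x)) * poly q (exp x)) has_field_derivative
      exp (- (c * x)) * poly (exp_pderiv c q) (exp x)) (at x)" for q x
    unfolding exp_pderiv_def
    by (auto intro!: derivative_eq_intros DERIV_chain2[OF poly_DERIV] simp: algebra_simps)
  then show ?case
    by (auto simp: Suc.IH intro!: DERIV_imp_deriv)
qed simp

text \<open>By the induction hypothesis for \<open>p\<close> and for \<open>exp_pderiv c p\<close>,
  the \<open>k\<close>-th power divides both, hence also \<open>[:0, 1:] * pderiv p\<close>. As
  \<open>z\<close> is nonzero, the factor \<open>[:0, 1:]\<close> has order 0 there, so
  \<open>pderiv p\<close> has order at least \<open>k\<close> at the root \<open>z\<close> of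
  \<open>p\<close>, and \<open>p\<close> itself has one more.\<close>

lemma power_dvd_if_exp_pderiv_roots:
  assumes "z \<noteq> 0" and "\<And>s. s < k \<Longrightarrow> poly ((exp_pderiv c ^^ s) p) z = 0"
  shows "[:- z, 1:] ^ k dvd p"
  using assms(2)
proof (induction k arbitrary: p)
  case (Suc k)
  show ?case
  proof (cases "p = 0")
    case False
    have root: "poly p z = 0"
      using Suc.prems[of 0] by simp
    have "[:- z, 1:] ^ k dvd p"
      using Suc.prems by (intro Suc.IH) simp
    moreover have "[:- z, 1:] ^ k dvd exp_pderiv c p"
    proof (rule Suc.IH)
      fix s assume "s < k"
      then show "poly ((exp_pderiv c ^^ s) (exp_pderiv c p)) z = 0"
        using Suc.prems[of "Suc s"] by (simp add: funpow_Suc_right del: funpow.simps)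
    qed
    ultimately have "[:- z, 1:] ^ k dvd exp_pderiv c p + smult c p"
      by (intro dvd_add dvd_smult)
    then have dvd: "[:- z, 1:] ^ k dvd [:0, 1:] * pderiv p"
      by (simp add: exp_pderiv_def)
    \<comment> \<open>Divisibility bounds the order only of a nonzero polynomial. A vanishing
      derivative would make \<open>p\<close> a nonzero constant, which has no root.\<close>
    have nz: "pderiv p \<noteq> 0"
    proof
      assume "pderiv p = 0"
      then obtain k where "p = [:k:]"
        by (auto simp: pderiv_eq_0_iff elim: degree_eq_zeroE)
      then show False
        using root False by simp
    qed
    then have "[:0, 1:] * pderiv p \<noteq> 0"
      by (metis mult_eq_0_iff one_neq_zero pCons_eq_0_iff)
    moreover have "order z [:0, 1:] = 0"
      using \<open>z \<noteq> 0\<close> by (intro order_0I) simp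
    ultimately have "k \<le> order z (pderiv p)"
      using dvd unfolding order_divides by (simp add: order_mult del: mult_pCons_left)
    then show ?thesis
      using order_pderiv[OF False root] by (simp add: order_divides del: power_Suc)
  qed simp
qed simp

text \<open>Splitting off the power at \<open>z i\<close> leaves a cofactor \<open>q\<close>. The
  removed factor has order 0 at every other \<open>z j\<close>, so \<open>q\<close> keeps the full
  order of \<open>p\<close> there and the induction continues with \<open>q\<close>.\<close>

lemma prod_linear_powers_dvd:
  fixes p :: "'a::field poly"
  assumes "finite A" "inj_on z A" "\<And>j. j \<in> A \<Longrightarrow> [:- z j, 1:] ^ k j dvd p"
  shows "(\<Prod>j\<in>A. [:- z j, 1:] ^ k j) dvd p"
  using assms
proof (induction A arbitrary: p rule: finite_induct)
  case (insert i A)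
  obtain q where p: "p = [:- z i, 1:] ^ k i * q"
    using insert.prems(2)[of i] by auto
  have "(\<Prod>j\<in>A. [:- z j, 1:] ^ k j) dvd q"
  proof (rule insert.IH)
    show "inj_on z A"
      using insert.prems(1) by simp
    fix j assume j: "j \<in> A"
    then have ne: "z i \<noteq> z j"
      using insert.prems(1) insert.hyps(2) by auto
    show "[:- z j, 1:] ^ k j dvd q"
    proof (cases "q = 0")
      case False
      then have "p \<noteq> 0"
        by (simp add: p)
      moreover have "order (z j) ([:- z i, 1:] ^ k i) = 0"
        using ne by (intro order_0I) simp
      moreover have "[:- z j, 1:] ^ k j dvd p"
        using insert.prems(2) j by simp
      ultimately show ?thesis
        unfolding order_divides by (simp add: p order_mult)
    qed simp
  qed
  then show ?case
    using insert.hyps by (simp add: p mult_dvd_mono)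
qed simp

lemma exp_poly_eq_poly_exp:
  obtains p where "degree p \<le> 2 * n"
    and "exp_poly n a b = (\<lambda>x. exp (- (real n * x)) * poly p (exp x))"
proof
  \<comment> \<open>Written in exponentials, the frequencies of \<open>exp_poly\<close> run from
    \<open>-n\<close> to \<open>n\<close>; multiplication by \<open>exp (n x)\<close> shifts them to
    the exponents 0 to \<open>2 * n\<close>.\<close>
  let ?p = "monom (a 0 / 2) n +
    (\<Sum>l = 1..n. monom ((a l + b l) / 2) (n + l) + monom ((a l - b l) / 2) (n - l))"
  have "degree (monom (a 0 / 2) n) \<le> 2 * n"
    by (rule order_trans[OF degree_monom_le]) simp
  moreover have "degree (monom ((a l + b l) / 2) (n + l) + monom ((a l - b l) / 2) (n - l)) \<le> 2 * n"
    if "l \<in> {1..n}" for l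
    using that by (intro degree_add_le; intro order_trans[OF degree_monom_le]) auto
  ultimately show "degree ?p \<le> 2 * n"
    by (intro degree_add_le[OF _ degree_sum_le]) auto
  show "exp_poly n a b = (\<lambda>x. exp (- (real n * x)) * poly ?p (exp x))"
  proof
    fix x
    have "exp (- (real n * x)) * exp x ^ n = 1"
      by (simp add: exp_of_nat_mult[symmetric] exp_minus)
    moreover have "a l * cosh (real l * x) + b l * sinh (real l * x) =
        exp (- (real n * x)) * ((a l + b l) / 2 * exp x ^ (n + l) + (a l - b l) / 2 * exp x ^ (n - l))"
      if "l \<in> {1..n}" for l
    proof -
      have "exp (- (real n * x)) * exp x ^ (n + l) = exp (real l * x)"
        by (simp add: exp_of_nat_mult[symmetric] mult_exp_exp algebra_simps)
      moreover have "exp (- (real n * x)) * exp x ^ (n - l) = exp (- (real l * x))"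
        using that
        by (simp add: exp_of_nat_mult[symmetric] mult_exp_exp algebra_simps of_nat_diff)
      ultimately show ?thesis
        unfolding cosh_field_def sinh_field_def
        by (simp add: algebra_simps add_divide_distrib diff_divide_distrib)
    qed
    ultimately show "exp_poly n a b x = exp (- (real n * x)) * poly ?p (exp x)"
      by (simp add: exp_poly_def poly_sum poly_monom distrib_left sum_distrib_left mult.left_commute)
  qed
qed

lemma exp_diff_eq_sinh: "exp x - exp y = 2 * exp ((x + y) / 2) * sinh ((x - y) / 2)" for x y :: real
proof -
  have "exp x = exp ((x + y) / 2) * exp ((x - y) / 2)" "exp y = exp ((x + y) / 2) * exp (- ((x - y) / 2))"
    by (simp_all add: mult_exp_exp add_divide_distrib diff_divide_distrib)
  then show ?thesis
    unfolding sinh_field_def by (simp add: algebra_simps)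
qed

text \<open>A degree count: the powers of linear factors forced by the roots already have total
  degree \<open>2 * n\<close>, the largest degree possible for \<open>p\<close>, so the cofactor is
  constant. The value 0 of \<open>K\<close> is not excluded at this stage.\<close>

lemma exp_poly_eq_sinh_prod:
  assumes "finite I" "inj_on r I"
    and mult: "\<And>j. j \<in> I \<Longrightarrow> has_root_mult (exp_poly n a b) (r j) (\<alpha> j)"
    and mult_sum: "(\<Sum>j\<in>I. \<alpha> j) = 2 * n"
  obtains K where "\<And>x. exp_poly n a b x = K * (\<Prod>j\<in>I. sinh ((x - r j) / 2) ^ \<alpha> j)"
proof -
  obtain p where deg: "degree p \<le> 2 * n"
    and p: "exp_poly n a b = (\<lambda>x. exp (- (real n * x)) * poly p (exp x))"
    by (rule exp_poly_eq_poly_exp)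
  let ?P = "\<Prod>j\<in>I. [:- exp (r j), 1:] ^ \<alpha> j"
  have "?P dvd p"
  proof (rule prod_linear_powers_dvd)
    show "inj_on (\<lambda>j. exp (r j)) I"
      using assms(2) by (simp add: inj_on_def)
    fix j assume "j \<in> I"
    then show "[:- exp (r j), 1:] ^ \<alpha> j dvd p"
      using mult[of j]
      by (intro power_dvd_if_exp_pderiv_roots[where c = "real n"])
         (auto simp: has_root_mult_def p higher_deriv_exp_poly)
  qed fact
  then obtain q where q: "p = ?P * q" ..
  have "?P \<noteq> 0"
    using assms(1) by simp
  moreover have "degree ?P = 2 * n"
    by (subst degree_prod_sum_eq) (simp_all add: degree_power_eq mult_sum)
  ultimately have "degree q = 0"
    using deg by (cases "q = 0") (auto simp: q degree_mult_eq)
  then obtain k where k: "q = [:k:]"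
    by (rule degree_eq_zeroE)
  \<comment> \<open>Each linear factor contributes one \<open>exp (x / 2)\<close>. As the
    multiplicities add up to \<open>2 * n\<close>, these combine to \<open>exp (n x)\<close>, which
    cancels the prefactor; the parts depending only on the roots go into the constant.\<close>
  have "exp_poly n a b x =
      (k * (\<Prod>j\<in>I. (2 * exp (r j / 2)) ^ \<alpha> j)) * (\<Prod>j\<in>I. sinh ((x - r j) / 2) ^ \<alpha> j)" for x
  proof -
    have "(\<Prod>j\<in>I. exp (x / 2) ^ \<alpha> j) = exp (x / 2) ^ (2 * n)"
      by (simp add: power_sum[symmetric] mult_sum)
    also have "\<dots> = exp (real n * x)"
      by (simp add: exp_of_nat_mult[symmetric])
    finally have e: "exp (- (real n * x)) * (\<Prod>j\<in>I. exp (x / 2) ^ \<alpha> j) = 1"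
      by (simp add: exp_minus)
    have "exp x - exp (r j) = exp (x / 2) * ((2 * exp (r j / 2)) * sinh ((x - r j) / 2))" for j
      by (simp add: exp_diff_eq_sinh add_divide_distrib exp_add)
    then have "poly ?P (exp x) = (\<Prod>j\<in>I. exp (x / 2) ^ \<alpha> j) *
        ((\<Prod>j\<in>I. (2 * exp (r j / 2)) ^ \<alpha> j) * (\<Prod>j\<in>I. sinh ((x - r j) / 2) ^ \<alpha> j))"
      by (simp add: poly_prod poly_power power_mult_distrib prod.distrib)
    then have "exp_poly n a b x = (exp (- (real n * x)) * (\<Prod>j\<in>I. exp (x / 2) ^ \<alpha> j)) *
        ((k * (\<Prod>j\<in>I. (2 * exp (r j / 2)) ^ \<alpha> j)) * (\<Prod>j\<in>I. sinh ((x - r j) / 2) ^ \<alpha> j))"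
      by (simp add: p q k mult_ac)
    then show ?thesis
      by (simp only: e mult_1)
  qed
  then show thesis
    by (rule that)
qed

section \<open>Hyperbolic estimates\<close>

lemma abs_tanh_le: "\<bar>tanh u\<bar> \<le> \<bar>u\<bar>" for u :: real
proof -
  have *: "tanh v \<le> v" if "v > 0" for v :: real
  proof -
    have "\<exists>z. 0 < z \<and> z < v \<and> tanh v - tanh 0 = (v - 0) * (1 - tanh z ^ 2)"
      using that by (intro MVT2) (auto intro!: derivative_eq_intros)
    then obtain z where "tanh v = v - v * tanh z ^ 2"
      by (auto simp: algebra_simps)
    then show ?thesis
      using that by simp
  qed
  show ?thesis
    using *[of "\<bar>u\<bar>"] by (cases "u = 0") auto
qed

text \<open>The mean value theorem gives \<open>v - tanh v = v * tanh z ^ 2\<close> with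
  \<open>0 < z < v\<close>, and \<open>tanh z\<close> is at most \<open>v\<close>. Negative
  arguments follow by oddness.\<close>

lemma abs_diff_tanh_le: "\<bar>u - tanh u\<bar> \<le> \<bar>u\<bar> ^ 3" for u :: real
proof -
  have *: "\<bar>v - tanh v\<bar> \<le> v ^ 3" if "v > 0" for v :: real
  proof -
    have "\<exists>z. 0 < z \<and> z < v \<and> tanh v - tanh 0 = (v - 0) * (1 - tanh z ^ 2)"
      using that by (intro MVT2) (auto intro!: derivative_eq_intros)
    then obtain z where z: "0 < z" "z < v" "v - tanh v = v * tanh z ^ 2"
      by (auto simp: algebra_simps)
    have "tanh z ^ 2 \<le> v ^ 2"
      using abs_tanh_le[of z] z by (intro power_mono) auto
    then show ?thesis
      using z that by (simp add: power3_eq_cube power2_eq_square mult_left_mono)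
  qed
  show ?thesis
    using *[of u] *[of "- u"] by (cases u "0::real" rule: linorder_cases) (auto simp: abs_minus_commute)
qed

text \<open>Serves to turn \<open>cosh (c / 2) < 2\<close> into the linear bound
  \<open>sinh (e / 2) \<le> e\<close>.\<close>

lemma sinh_le_mult_cosh:
  fixes u v :: real
  assumes "0 \<le> u" "u \<le> v"
  shows "sinh u \<le> u * cosh v"
proof (cases "u = 0")
  case False
  then have "\<exists>z. 0 < z \<and> z < u \<and> sinh u - sinh 0 = (u - 0) * cosh z"
    using assms by (intro MVT2) (auto intro!: derivative_eq_intros)
  then obtain z where z: "0 < z" "z < u" "sinh u = u * cosh z"
    by auto
  then show ?thesis
    using assms by (simp add: cosh_real_nonneg_le_iff mult_left_mono)
qed simp

text \<open>The difference of the two \<open>coth\<close> values is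
  \<open>sinh (v - u) / (sinh u * sinh v)\<close>, and \<open>sinh\<close> is monotone. Only
  absolute values enter, so \<open>u\<close> and \<open>v\<close> may have any signs.\<close>

lemma abs_coth_diff_le:
  fixes u v s h :: real
  assumes "s > 0" "s \<le> \<bar>u\<bar>" "s \<le> \<bar>v\<bar>" "\<bar>u - v\<bar> \<le> h"
  shows "\<bar>cosh u / sinh u - cosh v / sinh v\<bar> \<le> sinh h / sinh s ^ 2"
proof -
  have "sinh u \<noteq> 0" "sinh v \<noteq> 0"
    using assms by auto
  then have "cosh u / sinh u - cosh v / sinh v = sinh (v - u) / (sinh u * sinh v)"
    by (simp add: sinh_diff field_simps)
  then have "\<bar>cosh u / sinh u - cosh v / sinh v\<bar> = sinh \<bar>u - v\<bar> / (sinh \<bar>u\<bar> * sinh \<bar>v\<bar>)"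
    by (simp add: abs_mult abs_minus_commute flip: sinh_real_abs)
  also have "\<dots> \<le> sinh h / (sinh s * sinh s)"
    using assms by (intro frac_le mult_mono) (auto simp del: sinh_real_abs)
  finally show ?thesis
    by (simp add: power2_eq_square)
qed

section \<open>The iteration step\<close>

text \<open>This is the logarithmic derivative of the product. The constant \<open>K\<close> lets it
  cover both \<open>E\<close> and, with \<open>K = 1\<close>, the product
  \<open>Q_prod\<close>.\<close>

lemma has_field_derivative_sinh_prod:
  fixes y K :: real
  assumes "\<And>j. j \<in> A \<Longrightarrow> y \<noteq> r j"
  shows "((\<lambda>x. K * (\<Prod>j\<in>A. sinh ((x - r j) / 2) ^ \<alpha> j)) has_field_derivative
      K * (\<Prod>j\<in>A. sinh ((y - r j) / 2) ^ \<alpha> j) *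
        (\<Sum>j\<in>A. real (\<alpha> j) / 2 * (cosh ((y - r j) / 2) / sinh ((y - r j) / 2)))) (at y)"
proof -
  let ?f' = "\<lambda>j. real (\<alpha> j) * sinh ((y - r j) / 2) ^ (\<alpha> j - 1) * (cosh ((y - r j) / 2) / 2)"
  have "((\<lambda>x. \<Prod>j\<in>A. sinh ((x - r j) / 2) ^ \<alpha> j) has_field_derivative
      (\<Prod>j\<in>A. sinh ((y - r j) / 2) ^ \<alpha> j) * (\<Sum>j\<in>A. ?f' j / sinh ((y - r j) / 2) ^ \<alpha> j)) (at y)"
    using assms by (intro has_field_derivative_prod') (auto intro!: derivative_eq_intros)
  moreover have "?f' j / sinh ((y - r j) / 2) ^ \<alpha> j =
      real (\<alpha> j) / 2 * (cosh ((y - r j) / 2) / sinh ((y - r j) / 2))" if "j \<in> A" for j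
    \<comment> \<open>The case split handles the truncated exponent \<open>\<alpha> j - 1\<close>:
      for \<open>\<alpha> j = 0\<close> both sides vanish.\<close>
    using assms[OF that] by (cases "\<alpha> j") (auto simp: field_simps)
  ultimately show ?thesis
    by (auto intro!: DERIV_cmult simp: mult.assoc)
qed

text \<open>In the bracket, the \<open>i\<close>-th term of the logarithmic derivative of
  \<open>E\<close> gives \<open>1 / T\<close>; every other term is paired with the corresponding one
  from \<open>Q_prod\<close>, and these differences form \<open>w\<close>. The factor
  \<open>E (y i)\<close> then cancels.\<close>

lemma root_step_sinh_prod:
  fixes K :: real
  assumes E: "\<And>x. E x = K * (\<Prod>j = 1..m. sinh ((x - r j) / 2) ^ \<alpha> j)"
    and "K \<noteq> 0" and i: "i \<in> {1..m}" and "\<alpha> i > 0"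
    and yr: "\<And>j. j \<in> {1..m} \<Longrightarrow> y i \<noteq> r j"
    and yy: "\<And>j. j \<in> {1..m} - {i} \<Longrightarrow> y i \<noteq> y j"
  defines "w \<equiv> (\<Sum>j\<in>{1..m} - {i}. real (\<alpha> j) *
      (cosh ((y i - r j) / 2) / sinh ((y i - r j) / 2) -
       cosh ((y i - y j) / 2) / sinh ((y i - y j) / 2))) / real (\<alpha> i)"
    and "T \<equiv> tanh ((y i - r i) / 2)"
  shows "root_step E m \<alpha> y i = y i - 2 * T / (1 + w * T)"
proof -
  let ?coth = "\<lambda>u::real. cosh u / sinh u"
  let ?I = "{1..m} - {i}"
  have Ey: "E (y i) \<noteq> 0"
    using \<open>K \<noteq> 0\<close> yr by (simp add: E)
  have "deriv E (y i) = E (y i) * (\<Sum>j = 1..m. real (\<alpha> j) / 2 * ?coth ((y i - r j) / 2))"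
    using has_field_derivative_sinh_prod[of "{1..m}" "y i" r K \<alpha>] yr
    by (intro DERIV_imp_deriv) (simp add: E[abs_def])
  also have "(\<Sum>j = 1..m. real (\<alpha> j) / 2 * ?coth ((y i - r j) / 2)) =
      real (\<alpha> i) / 2 * ?coth ((y i - r i) / 2) + (\<Sum>j\<in>?I. real (\<alpha> j) / 2 * ?coth ((y i - r j) / 2))"
    using i by (intro sum.remove) auto
  finally have dE: "deriv E (y i) = E (y i) * (real (\<alpha> i) / 2 * ?coth ((y i - r i) / 2) +
      (\<Sum>j\<in>?I. real (\<alpha> j) / 2 * ?coth ((y i - r j) / 2)))" .
  have "deriv (Q_prod m \<alpha> y i) (y i) =
      Q_prod m \<alpha> y i (y i) * (\<Sum>j\<in>?I. real (\<alpha> j) / 2 * ?coth ((y i - y j) / 2))"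
    using has_field_derivative_sinh_prod[of ?I "y i" y 1 \<alpha>] yy
    by (intro DERIV_imp_deriv) (simp add: Q_prod_def[abs_def])
  moreover have "Q_prod m \<alpha> y i (y i) \<noteq> 0"
    using yy by (simp add: Q_prod_def)
  ultimately have dQ: "deriv (Q_prod m \<alpha> y i) (y i) / Q_prod m \<alpha> y i (y i) =
      (\<Sum>j\<in>?I. real (\<alpha> j) / 2 * ?coth ((y i - y j) / 2))"
    by simp
  have half: "A = B + s / 2 * w" if "s * w = 2 * (A - B)" for A B s :: real
    using that by (simp add: field_simps)
  have "real (\<alpha> i) * w =
      (\<Sum>j\<in>?I. real (\<alpha> j) * (?coth ((y i - r j) / 2) - ?coth ((y i - y j) / 2)))"
    using \<open>\<alpha> i > 0\<close> by (simp add: w_def)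
  also have "\<dots> = 2 * ((\<Sum>j\<in>?I. real (\<alpha> j) / 2 * ?coth ((y i - r j) / 2)) -
      (\<Sum>j\<in>?I. real (\<alpha> j) / 2 * ?coth ((y i - y j) / 2)))"
    unfolding sum_subtractf[symmetric] sum_distrib_left
    by (intro sum.cong) (simp_all add: right_diff_distrib)
  finally have wA: "(\<Sum>j\<in>?I. real (\<alpha> j) / 2 * ?coth ((y i - r j) / 2)) =
      (\<Sum>j\<in>?I. real (\<alpha> j) / 2 * ?coth ((y i - y j) / 2)) + real (\<alpha> i) / 2 * w"
    by (rule half)
  have cT: "?coth ((y i - r i) / 2) = 1 / T"
    by (simp add: T_def tanh_def)
  have "deriv E (y i) - E (y i) * (deriv (Q_prod m \<alpha> y i) (y i) / Q_prod m \<alpha> y i (y i)) =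
      E (y i) * (real (\<alpha> i) / 2 * (1 / T + w))"
    unfolding dE dQ wA cT by (simp add: algebra_simps)
  then have step: "root_step E m \<alpha> y i =
      y i - real (\<alpha> i) * E (y i) * inverse (E (y i) * (real (\<alpha> i) / 2 * (1 / T + w)))"
    by (simp only: root_step_def)
  \<comment> \<open>The case \<open>X = 0\<close> holds because both sides are then 0 by the
    totality of division, so the bracket need not be known to be nonzero here.\<close>
  have cancel: "p * F * inverse (F * (p / 2 * X)) = 2 / X" if "p \<noteq> 0" "F \<noteq> 0" for p F X :: real
    using that by (cases "X = 0") (simp_all add: field_simps)
  have "real (\<alpha> i) * E (y i) * inverse (E (y i) * (real (\<alpha> i) / 2 * (1 / T + w))) = 2 / (1 / T + w)"
    by (rule cancel) (use Ey \<open>\<alpha> i > 0\<close> in auto)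
  moreover have "T \<noteq> 0"
    using yr[OF i] by (simp add: T_def)
  then have "2 / (1 / T + w) = 2 * T / (1 + w * T)"
    by (simp add: field_simps)
  ultimately show ?thesis
    by (simp only: step)
qed

text \<open>Over the common denominator \<open>1 + w * T\<close> the new error has numerator
  \<open>(t - 2 * T) + t * (w * T)\<close>, both summands being cubic in \<open>e\<close>. After
  division by \<open>e ^ 3 / c\<^sup>2\<close> it remains to see that
  \<open>c\<^sup>2 / 4 + v * c\<^sup>2 / 2\<close> is at most \<open>1 - v * c\<^sup>2 / 2\<close>,
  which the condition on \<open>v\<close> implies.\<close>

lemma cubic_error_bound:
  fixes t T w v e c :: real
  assumes t: "\<bar>t\<bar> \<le> e" and e: "e \<le> c" and "c > 0" and "v \<ge> 0"
    and w: "\<bar>w\<bar> \<le> v * e" and v: "c\<^sup>2 * (2 * v + 1) < 1"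
    and T: "T = tanh (t / 2)"
  shows "\<bar>t - 2 * T / (1 + w * T)\<bar> \<le> e ^ 3 / c\<^sup>2"
proof -
  have "e \<ge> 0"
    using t by linarith
  have Te: "\<bar>T\<bar> \<le> e / 2"
    using abs_tanh_le[of "t / 2"] t by (simp add: T)
  have "\<bar>t / 2 - T\<bar> \<le> (e / 2) ^ 3"
    unfolding T using t by (intro order_trans[OF abs_diff_tanh_le] power_mono) auto
  then have tT: "\<bar>t - 2 * T\<bar> \<le> e ^ 3 / 4"
    by (simp add: power_divide abs_if split: if_splits)
  have wT: "\<bar>w * T\<bar> \<le> v * e\<^sup>2 / 2"
    using mult_mono[OF w Te] \<open>v \<ge> 0\<close> \<open>e \<ge> 0\<close> by (simp add: abs_mult power2_eq_square)
  have "e\<^sup>2 \<le> c\<^sup>2"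
    using e \<open>e \<ge> 0\<close> by (intro power_mono)
  then have "v * e\<^sup>2 \<le> v * c\<^sup>2"
    using \<open>v \<ge> 0\<close> by (rule mult_left_mono)
  then have den: "1 + w * T \<ge> 1 - v * c\<^sup>2 / 2"
    using wT by linarith
  have vc: "2 * (v * c\<^sup>2) + c\<^sup>2 < 1" "v * c\<^sup>2 \<ge> 0"
    using v \<open>v \<ge> 0\<close> by (simp_all add: algebra_simps)
  then have pos: "1 + w * T > 0"
    using den zero_le_power2[of c] by linarith
  have "\<bar>t * (w * T)\<bar> \<le> e * (v * e\<^sup>2 / 2)"
    unfolding abs_mult[of t] using t wT \<open>e \<ge> 0\<close> by (intro mult_mono) auto
  then have "\<bar>t - 2 * T + t * (w * T)\<bar> \<le> e ^ 3 / 4 + e * (v * e\<^sup>2 / 2)"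
    using tT by linarith
  also have "\<dots> = e ^ 3 * (1 / 4 + v / 2)"
    by (simp add: algebra_simps power2_eq_square power3_eq_cube)
  also have "\<dots> = e ^ 3 / c\<^sup>2 * (c\<^sup>2 / 4 + v * c\<^sup>2 / 2)"
    using \<open>c > 0\<close> by (simp add: field_simps)
  also have "c\<^sup>2 / 4 + v * c\<^sup>2 / 2 \<le> 1 + w * T"
    using den vc zero_le_power2[of c] by linarith
  then have "e ^ 3 / c\<^sup>2 * (c\<^sup>2 / 4 + v * c\<^sup>2 / 2) \<le> e ^ 3 / c\<^sup>2 * (1 + w * T)"
    using \<open>e \<ge> 0\<close> by (intro mult_left_mono) auto
  finally have "\<bar>t - 2 * T + t * (w * T)\<bar> / (1 + w * T) \<le> e ^ 3 / c\<^sup>2"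
    using pos by (simp add: pos_divide_le_eq)
  moreover have "t - 2 * T / (1 + w * T) = (t - 2 * T + t * (w * T)) / (1 + w * T)"
    using pos by (simp add: field_simps)
  ultimately show ?thesis
    using pos by simp
qed

lemma root_step_error_le:
  fixes K c d e S :: real
  assumes E: "\<And>x. E x = K * (\<Prod>j = 1..m. sinh ((x - r j) / 2) ^ \<alpha> j)"
    and "K \<noteq> 0" and i: "i \<in> {1..m}" and \<alpha>: "\<alpha> i > 0"
    and mult_sum: "(\<Sum>j = 1..m. \<alpha> j) = 2 * n"
    and sep: "\<And>j. j \<in> {1..m} - {i} \<Longrightarrow> d \<le> \<bar>r i - r j\<bar>"
    and "c > 0" and dc: "d - 2 * c > 0" and c_cosh: "cosh (c / 2) < 2"
    and S: "S = sinh ((d - 2 * c) / 2)"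
    and c_S: "c\<^sup>2 * (4 * real n + (S\<^sup>2 - 2) * real (\<alpha> i)) < S\<^sup>2 * real (\<alpha> i)"
    and e: "e \<le> c" and y: "\<And>j. j \<in> {1..m} \<Longrightarrow> \<bar>y j - r j\<bar> \<le> e"
  shows "\<bar>root_step E m \<alpha> y i - r i\<bar> \<le> e ^ 3 / c\<^sup>2"
\<comment> \<open>At an exact root the factor \<open>E (y i) = 0\<close> annihilates the correction,
  whatever the inverse of the bracket is.\<close>
proof (cases "y i = r i")
  case True
  have "E (y i) = 0"
    using i \<alpha> by (auto simp: E True intro!: prod_zero)
  then show ?thesis
    using True y[OF i] by (simp add: root_step_def)
next
  case False
  let ?I = "{1..m} - {i}"
  let ?coth = "\<lambda>u::real. cosh u / sinh u"
  have e0: "e \<ge> 0"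
    using y[OF i] by linarith
  have S0: "S > 0"
    using dc by (simp add: S)
  \<comment> \<open>Starting from a root distance of at least \<open>d\<close>, at most two
    approximations are moved, each by at most \<open>c\<close>. After halving, the bound becomes the
    argument of \<open>sinh\<close> in \<open>S\<close>.\<close>
  have far: "d - 2 * c \<le> \<bar>y i - r j\<bar>" "d - 2 * c \<le> \<bar>y i - y j\<bar>" if "j \<in> ?I" for j
    using sep[OF that] y[OF i] y[of j] that e \<open>c > 0\<close> by auto
  define w where "w = (\<Sum>j\<in>?I. real (\<alpha> j) *
      (?coth ((y i - r j) / 2) - ?coth ((y i - y j) / 2))) / real (\<alpha> i)"
  \<comment> \<open>The other multiplicities sum to \<open>2 * n - \<alpha> i\<close> and each
    \<open>coth\<close> difference is at most \<open>e / S\<^sup>2\<close>, so \<open>v * e\<close>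
    bounds \<open>w\<close>. With this \<open>v\<close>, the hypothesis \<open>c_S\<close> is
    exactly \<open>c\<^sup>2 * (2 * v + 1) < 1\<close>.\<close>
  define v where "v = (2 * real n - real (\<alpha> i)) / (real (\<alpha> i) * S\<^sup>2)"
  have "real (\<Sum>j = 1..m. \<alpha> j) = real (\<alpha> i) + (\<Sum>j\<in>?I. real (\<alpha> j))"
    using i by (simp add: sum.remove)
  then have rest: "(\<Sum>j\<in>?I. real (\<alpha> j)) = 2 * real n - real (\<alpha> i)"
    unfolding mult_sum by simp
  then have "2 * real n - real (\<alpha> i) \<ge> 0"
    by (metis sum_nonneg of_nat_0_le_iff)
  then have v0: "v \<ge> 0"
    by (simp add: v_def)
  have "c\<^sup>2 * (2 * v + 1) = c\<^sup>2 * (4 * real n + (S\<^sup>2 - 2) * real (\<alpha> i)) / (S\<^sup>2 * real (\<alpha> i))"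
    using \<alpha> S0 by (simp add: v_def field_simps)
  also have "\<dots> < 1"
    using c_S \<alpha> S0 by (simp add: divide_less_eq)
  finally have vc: "c\<^sup>2 * (2 * v + 1) < 1" .
  have "sinh (e / 2) \<le> e / 2 * cosh (c / 2)"
    using e e0 by (intro sinh_le_mult_cosh) auto
  also have "\<dots> \<le> e / 2 * 2"
    using c_cosh e0 by (intro mult_left_mono) auto
  finally have sinh_e: "sinh (e / 2) \<le> e"
    by simp
  have "\<bar>?coth ((y i - r j) / 2) - ?coth ((y i - y j) / 2)\<bar> \<le> e / S\<^sup>2" if j: "j \<in> ?I" for j
  proof -
    have "\<bar>(y i - r j) / 2 - (y i - y j) / 2\<bar> \<le> e / 2"
      using y[of j] j by (simp add: field_simps abs_if split: if_splits)
    then have "\<bar>?coth ((y i - r j) / 2) - ?coth ((y i - y j) / 2)\<bar> \<le>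
        sinh (e / 2) / sinh ((d - 2 * c) / 2) ^ 2"
      using far[OF j] dc by (intro abs_coth_diff_le) auto
    also have "\<dots> \<le> e / S\<^sup>2"
      using sinh_e by (simp add: S divide_right_mono)
    finally show ?thesis .
  qed
  then have "\<bar>\<Sum>j\<in>?I. real (\<alpha> j) * (?coth ((y i - r j) / 2) - ?coth ((y i - y j) / 2))\<bar> \<le>
      (\<Sum>j\<in>?I. real (\<alpha> j) * (e / S\<^sup>2))"
    by (intro order_trans[OF sum_abs] sum_mono) (simp add: abs_mult mult_left_mono del: times_divide_eq_right)
  also have "\<dots> = v * e * real (\<alpha> i)"
    unfolding sum_distrib_right[symmetric] rest using \<alpha> S0 by (simp add: v_def field_simps)
  finally have w: "\<bar>w\<bar> \<le> v * e"
    using \<alpha> by (simp add: w_def pos_divide_le_eq)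
  define t where "t = y i - r i"
  have "root_step E m \<alpha> y i = y i - 2 * tanh ((y i - r i) / 2) / (1 + w * tanh ((y i - r i) / 2))"
    unfolding w_def
  proof (rule root_step_sinh_prod[OF E])
    show "y i \<noteq> r j" if "j \<in> {1..m}" for j
      using False far(1)[of j] dc that by (cases "j = i") auto
    show "y i \<noteq> y j" if "j \<in> ?I" for j
      using far(2)[OF that] dc by auto
  qed fact+
  then have "root_step E m \<alpha> y i - r i = t - 2 * tanh (t / 2) / (1 + w * tanh (t / 2))"
    by (simp add: t_def)
  moreover have "\<bar>t\<bar> \<le> e"
    using y[OF i] by (simp add: t_def)
  ultimately show ?thesis
    using cubic_error_bound[OF _ e \<open>c > 0\<close> v0 w vc refl] by simp
qed

theorem theorem3:
  fixes n m :: nat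
    and a b :: "nat \<Rightarrow> real"
    and r :: "nat \<Rightarrow> real"
    and \<alpha> :: "nat \<Rightarrow> nat"
    and d q c S :: real
    and x :: "nat \<Rightarrow> nat \<Rightarrow> real"
  assumes leading: "a n \<noteq> 0 \<or> b n \<noteq> 0"
    and distinct: "inj_on r {1..m}"
    and mult: "\<And>i. i \<in> {1..m} \<Longrightarrow> has_root_mult (exp_poly n a b) (r i) (\<alpha> i)"
    and mult_sum: "(\<Sum>i = 1..m. \<alpha> i) = 2 * n"
    \<comment> \<open>for a single root the minimum ranges over no pairs, and \<open>d\<close> is left arbitrary\<close>
    and d_min: "m \<ge> 2 \<Longrightarrow>
      d = Min {\<bar>r i - r j\<bar> | i j. i \<in> {1..m} \<and> j \<in> {1..m} \<and> i \<noteq> j}"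
    and q: "1 > q" "q > 0"
    and c: "c > 0"
    and dc: "d - 2 * c > 0"
    and c_cosh_sinh: "1 / 2 * cosh (c / 2) + 1 / 8 * c * \<bar>sinh (c / 2)\<bar> < 6"
    and c_cosh: "cosh (c / 2) < 2"
    and S: "S = sinh ((d - 2 * c) / 2)"
    and c_S: "\<And>i. i \<in> {1..m} \<Longrightarrow>
      c\<^sup>2 * (4 * real n + (S\<^sup>2 - 2) * real (\<alpha> i)) < S\<^sup>2 * real (\<alpha> i)"
    and init: "\<And>i. i \<in> {1..m} \<Longrightarrow> \<bar>x 0 i - r i\<bar> \<le> c * q"
    and iter: "\<And>k i. i \<in> {1..m} \<Longrightarrow>
      x (Suc k) i = root_step (exp_poly n a b) m \<alpha> (x k) i"
  shows "\<forall>k. \<forall>i \<in> {1..m}. \<bar>x k i - r i\<bar> \<le> c * q ^ (3 ^ k)"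
proof
  fix k
  let ?E = "exp_poly n a b"
  obtain K where E: "\<And>x. ?E x = K * (\<Prod>j = 1..m. sinh ((x - r j) / 2) ^ \<alpha> j)"
    using exp_poly_eq_sinh_prod[OF _ distinct mult mult_sum] by auto
  \<comment> \<open>With \<open>K = 0\<close> all derivatives of \<open>?E\<close> would vanish,
    against the nonzero \<open>\<alpha> i\<close>-th derivative at \<open>r i\<close>. The index
    \<open>i\<close> guarantees that there is a root to argue with.\<close>
  have K: "K \<noteq> 0" if i: "i \<in> {1..m}" for i
  proof
    assume "K = 0"
    then have "?E = (\<lambda>x. 0)"
      using E by auto
    moreover have "(deriv ^^ s) (\<lambda>x::real. 0::real) = (\<lambda>x. 0)" for s
      by (induction s) simp_all
    ultimately show False
      using mult[OF i] by (simp add: has_root_mult_def)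
  qed
  have sep: "d \<le> \<bar>r i - r j\<bar>" if "i \<in> {1..m}" "j \<in> {1..m} - {i}" for i j
  proof -
    let ?D = "{\<bar>r i - r j\<bar> | i j. i \<in> {1..m} \<and> j \<in> {1..m} \<and> i \<noteq> j}"
    have "?D \<subseteq> (\<lambda>(i, j). \<bar>r i - r j\<bar>) ` ({1..m} \<times> {1..m})"
      by auto
    then have "finite ?D"
      by (rule finite_subset) simp
    moreover have "\<bar>r i - r j\<bar> \<in> ?D"
      using that by blast
    ultimately have "Min ?D \<le> \<bar>r i - r j\<bar>"
      by (rule Min_le)
    moreover have "m \<ge> 2"
      using that by auto
    ultimately show ?thesis
      by (simp only: d_min)
  qed
  show "\<forall>i \<in> {1..m}. \<bar>x k i - r i\<bar> \<le> c * q ^ (3 ^ k)"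
  proof (induction k)
    case 0
    then show ?case
      using init by simp
  next
    case (Suc k)
    show ?case
    proof
      fix i assume i: "i \<in> {1..m}"
      have "c * q ^ 3 ^ k \<le> c"
        using q c by (simp add: power_le_one)
      moreover have "\<alpha> i > 0"
        using mult[OF i] by (simp add: has_root_mult_def)
      ultimately have "\<bar>root_step ?E m \<alpha> (x k) i - r i\<bar> \<le> (c * q ^ 3 ^ k) ^ 3 / c\<^sup>2"
        using Suc.IH
        by (intro root_step_error_le[OF E K[OF i] i _ mult_sum sep[OF i] c dc c_cosh S c_S[OF i]]) auto
      \<comment> \<open>Dividing by \<open>c\<^sup>2\<close> leaves a single factor \<open>c\<close>
        after cubing, so the bound reproduces its own form with the exponent of \<open>q\<close>
        tripled.\<close>
      also have "\<dots> = c * (q ^ 3 ^ k) ^ 3"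
        using c by (simp add: power_mult_distrib power2_eq_square power3_eq_cube)
      also have "\<dots> = c * q ^ 3 ^ Suc k"
        by (simp add: power_mult[symmetric] mult.commute)
      finally show "\<bar>x (Suc k) i - r i\<bar> \<le> c * q ^ 3 ^ Suc k"
        by (simp add: iter[OF i])
    qed
  qed
qed

end
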